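(* There is no uniform constant bound, independent of $n$, for the numbers of pairs needed to generate congruences on the twisted partition monoids $\mathcal{P}_n^\Phi$. Indeed, for every $n\geq 2$ there exists a congruence $\sigma$ on $\mathcal{P}_n^\Phi$ such that every set $\Omega\subseteq\mathcal{P}_n^\Phi\times\mathcal{P}_n^\Phi$ generating $\sigma$ as a congruence satisfies $|\Omega|\geq n-1$.
   Context: Let $\mathbb{N}=\{0,1,2,\dots\}$ and, for $n\ge 1$, let $[n]=\{1,\dots,n\}$, with disjoint copies $[n]'=\{1',\dots,n'\}$ and $[n]''=\{1'',\dots,n''\}$. The partition monoid $\mathcal{P}_n$ consists of all set partitions of $[n]\cup[n]'$. For $\alpha,\beta\in\mathcal{P}_n$ the product graph $\Gamma(\alpha,\beta)$ has vertex set $[n]\cup[n]''\cup[n]'$; two vertices of $[n]\cup[n]''$ are joined when they lie in a common block of $\alpha$ after renaming each $x'$ of $\alpha$ to $x''$, and two vertices of $[n]''\cup[n]'$ are joined when they lie in a common block of $\beta$ after renaming each $x$ of $\beta$ to $x''$. The product $\alpha\beta\in\mathcal{P}_n$ is the partition in which $x,y\in[n]\cup[n]'$ are in the same block iff they lie in the same connected component of $\Gamma(\alpha,\beta)$. $\Phi(\alpha,\beta)$ is the number of connected components of $\Gamma(\alpha,\beta)$ wholly contained in $[n]''$. The twisted partition monoid is $\mathcal{P}_n^\Phi=\mathbb{N}\times\mathcal{P}_n$ with product $(i,\alpha)(j,\beta)=(i+j+\Phi(\alpha,\beta),\alpha\beta)$. A congruence $\sigma$ on a monoid $M$ is generated by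 $\Omega\subseteq M\times M$ if $\sigma$ is the least congruence on $M$ containing $\Omega$. *)

theory Defs
  imports "HOL-Library.Disjoint_Sets" "HOL-Algebra.Group"
begin

(* Upper x, Lower x, Mid x stand for x, x', x''. *)
datatype vertex = Upper nat | Lower nat | Mid nat

definition points :: "nat \<Rightarrow> vertex set" where
  "points n = Upper ` {1..n} \<union> Lower ` {1..n}"

definition mids :: "nat \<Rightarrow> vertex set" where
  "mids n = Mid ` {1..n}"

definition partitions :: "nat \<Rightarrow> vertex set set set" where
  "partitions n = {\<alpha>. partition_on (points n) \<alpha>}"

fun lower_to_mid :: "vertex \<Rightarrow> vertex" where
  "lower_to_mid (Lower x) = Mid x"
| "lower_to_mid v = v"

fun upper_to_mid :: "vertex \<Rightarrow> vertex" where
  "upper_to_mid (Upper x) = Mid x"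
| "upper_to_mid v = v"

(* The relation carries loops at all vertices, which do not affect connected components. *)
definition product_graph :: "vertex set set \<Rightarrow> vertex set set \<Rightarrow> (vertex \<times> vertex) set" where
  "product_graph \<alpha> \<beta> =
     {(x, y). \<exists>A\<in>\<alpha>. x \<in> lower_to_mid ` A \<and> y \<in> lower_to_mid ` A} \<union>
     {(x, y). \<exists>B\<in>\<beta>. x \<in> upper_to_mid ` B \<and> y \<in> upper_to_mid ` B}"

definition product_components ::
    "nat \<Rightarrow> vertex set set \<Rightarrow> vertex set set \<Rightarrow> vertex set set" where
  "product_components n \<alpha> \<beta> = (points n \<union> mids n) // (product_graph \<alpha> \<beta>)\<^sup>*"

definition partition_mult ::
    "nat \<Rightarrow> vertex set set \<Rightarrow> vertex set set \<Rightarrow> vertex set set" where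
  "partition_mult n \<alpha> \<beta> =
     points n // {(x, y) \<in> points n \<times> points n. \<exists>C\<in>product_components n \<alpha> \<beta>. x \<in> C \<and> y \<in> C}"

definition floating :: "nat \<Rightarrow> vertex set set \<Rightarrow> vertex set set \<Rightarrow> nat" where
  "floating n \<alpha> \<beta> = card {C \<in> product_components n \<alpha> \<beta>. C \<subseteq> mids n}"

definition partition_one :: "nat \<Rightarrow> vertex set set" where
  "partition_one n = {{Upper x, Lower x} | x. x \<in> {1..n}}"

definition twisted_partition_monoid :: "nat \<Rightarrow> (nat \<times> vertex set set) monoid" where
  "twisted_partition_monoid n =
     \<lparr>carrier = UNIV \<times> partitions n,
      mult = (\<lambda>(i, \<alpha>) (j, \<beta>). (i + j + floating n \<alpha> \<beta>, partition_mult n \<alpha> \<beta>)),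
      one = (0, partition_one n)\<rparr>"

definition monoid_congruence :: "('a, 'b) monoid_scheme \<Rightarrow> ('a \<times> 'a) set \<Rightarrow> bool" where
  "monoid_congruence M \<sigma> \<longleftrightarrow>
     equiv (carrier M) \<sigma> \<and>
     (\<forall>(a, b)\<in>\<sigma>. \<forall>c\<in>carrier M.
        (c \<otimes>\<^bsub>M\<^esub> a, c \<otimes>\<^bsub>M\<^esub> b) \<in> \<sigma> \<and> (a \<otimes>\<^bsub>M\<^esub> c, b \<otimes>\<^bsub>M\<^esub> c) \<in> \<sigma>)"

definition generates_congruence ::
    "('a, 'b) monoid_scheme \<Rightarrow> ('a \<times> 'a) set \<Rightarrow> ('a \<times> 'a) set \<Rightarrow> bool" where
  "generates_congruence M \<Omega> \<sigma> \<longleftrightarrow>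
     monoid_congruence M \<sigma> \<and> \<Omega> \<subseteq> \<sigma> \<and>
     (\<forall>\<tau>. monoid_congruence M \<tau> \<and> \<Omega> \<subseteq> \<tau> \<longrightarrow> \<sigma> \<subseteq> \<tau>)"

end

theory Submission
  imports Defs
begin

text \<open>
  For \<open>2 \<le> q \<le> n\<close> let \<open>a q = (q, \<epsilon>)\<close>, where \<open>\<epsilon>\<close> is the idempotent of rank \<open>q\<close> that merges the points
  \<open>q, \<dots>, n\<close>. Multiplication can only raise the twist and lower the rank, so the \<open>a q\<close> form an
  antichain in the \<open>\<J>\<close>-order. On the ideal that they generate, relate \<open>x\<close> and \<open>y\<close> when \<open>u x v\<close> and
  \<open>u y v\<close> always lie above the same \<open>a q\<close>. By stability this congruence relates \<open>a q\<close> to its product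
  with the transposition of its first two blocks. Discarding the nontrivial pairs above one \<open>a q\<close>
  again leaves a congruence, so a generating set contains such a pair for every \<open>q\<close>; no pair serves
  two values of \<open>q\<close>, as its entries then lie in the \<open>\<J>\<close>-class of \<open>a q\<close>.

  Associativity of the twisted product comes from a faithful representation by matrices indexed by
  subsets of \<open>{1..n}\<close>: the entry of \<open>(i, \<alpha>)\<close> at \<open>(f, g)\<close> is \<open>2 ^ i\<close> if colouring \<open>f\<close> above and \<open>g\<close> below
  is constant on the blocks of \<open>\<alpha>\<close>, and \<open>0\<close> otherwise. Each floating component of a product accounts
  for a factor \<open>2\<close>.
\<close>

section \<open>Many generators from an antichain\<close>

lemma monoid_congruenceI:
  assumes "\<sigma> \<subseteq> carrier M \<times> carrier M"
    and "\<And>x. x \<in> carrier M \<Longrightarrow> (x, x) \<in> \<sigma>"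
    and "\<And>x y. (x, y) \<in> \<sigma> \<Longrightarrow> (y, x) \<in> \<sigma>"
    and "\<And>x y z. (x, y) \<in> \<sigma> \<Longrightarrow> (y, z) \<in> \<sigma> \<Longrightarrow> (x, z) \<in> \<sigma>"
    and "\<And>x y c. (x, y) \<in> \<sigma> \<Longrightarrow> c \<in> carrier M \<Longrightarrow> (c \<otimes>\<^bsub>M\<^esub> x, c \<otimes>\<^bsub>M\<^esub> y) \<in> \<sigma>"
    and "\<And>x y c. (x, y) \<in> \<sigma> \<Longrightarrow> c \<in> carrier M \<Longrightarrow> (x \<otimes>\<^bsub>M\<^esub> c, y \<otimes>\<^bsub>M\<^esub> c) \<in> \<sigma>"
  shows "monoid_congruence M \<sigma>"
proof -
  have "refl_on (carrier M) \<sigma>" "sym \<sigma>" "trans \<sigma>"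
    by (use assms(2) in \<open>simp add: refl_on_def\<close>, use assms(3) in \<open>blast intro: symI\<close>,
      use assms(4) in \<open>blast intro: transI\<close>)
  then show ?thesis
    unfolding monoid_congruence_def equiv_def using assms(1,5,6) by auto
qed

section \<open>The divisibility preorder of a monoid and stability\<close>

context monoid
begin

text \<open>This is the J-order: \<open>x\<close> lies above \<open>a\<close>, that is,
  \<open>a\<close> belongs to the two-sided ideal generated by \<open>x\<close>.\<close>

definition divs :: "'a \<Rightarrow> 'a \<Rightarrow> bool" where
  "divs x a \<longleftrightarrow> (\<exists>u\<in>carrier G. \<exists>v\<in>carrier G. u \<otimes> x \<otimes> v = a)"

lemma divs_refl: "a \<in> carrier G \<Longrightarrow> divs a a"
  unfolding divs_def by (intro bexI[of _ \<one>]) auto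

lemma divs_trans:
  assumes "divs x y" "divs y z" "x \<in> carrier G"
  shows "divs x z"
proof -
  obtain u v u' v' where uv: "u \<in> carrier G" "v \<in> carrier G" "u \<otimes> x \<otimes> v = y"
    and uv': "u' \<in> carrier G" "v' \<in> carrier G" "u' \<otimes> y \<otimes> v' = z"
    using assms(1,2) unfolding divs_def by blast
  have "(u' \<otimes> u) \<otimes> x \<otimes> (v \<otimes> v') = z"
    using uv uv' assms(3) by (auto simp: m_assoc)
  then show ?thesis
    unfolding divs_def using uv(1,2) uv'(1,2) by blast
qed

lemma divs_mult:
  assumes "x \<in> carrier G" "c \<in> carrier G"
  shows "divs x (c \<otimes> x)" "divs x (x \<otimes> c)"
  unfolding divs_def using assms by (metis one_closed l_one r_one m_closed)+

lemma pow_sandwich: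
  assumes "a \<in> carrier G" "s \<in> carrier G" "t \<in> carrier G" "s \<otimes> a \<otimes> t = a"
  shows "s [^] (k::nat) \<otimes> a \<otimes> t [^] k = a"
proof (induction k)
  case 0
  then show ?case using assms by simp
next
  case (Suc k)
  have "s [^] Suc k \<otimes> a \<otimes> t [^] Suc k = s [^] k \<otimes> (s \<otimes> a \<otimes> t) \<otimes> t [^] k"
    unfolding nat_pow_Suc2[OF assms(3), of k] unfolding nat_pow_Suc using assms(1-3)
    by (simp add: m_assoc)
  then show ?case using Suc assms(4) by simp
qed

text \<open>Stability: since \<open>s [^] k \<otimes> a\<close> runs through the finitely many divisors of \<open>a\<close>, two of
  these coincide, and right multiplication by \<open>t [^] k\<close> cancels the smaller power.\<close>

lemma stable_left:
  assumes "a \<in> carrier G" "s \<in> carrier G" "t \<in> carrier G" "s \<otimes> a \<otimes> t = a"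
    and fin: "finite {z \<in> carrier G. divs z a}"
  shows "\<exists>m::nat. s [^] Suc m \<otimes> a = a"
proof -
  have "divs (s [^] k \<otimes> a) a" for k :: nat
    unfolding divs_def using pow_sandwich[OF assms(1-4), of k] assms(1-3)
    by (intro bexI[of _ \<one>] bexI[of _ "t [^] k"]) auto
  then have "range (\<lambda>k::nat. s [^] k \<otimes> a) \<subseteq> {z \<in> carrier G. divs z a}"
    using assms(1,2) by auto
  then have "\<not> inj (\<lambda>k::nat. s [^] k \<otimes> a)"
    using fin infinite_UNIV_nat by (meson finite_imageD finite_subset)
  then obtain k l :: nat where "k < l" and eq: "s [^] k \<otimes> a = s [^] l \<otimes> a"
    unfolding inj_def by (metis linorder_neqE_nat)
  then obtain m where l: "l = Suc m + k"
    by (metis add.commute add_Suc_right less_imp_Suc_add)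
  have "a = s [^] l \<otimes> a \<otimes> t [^] k"
    using pow_sandwich[OF assms(1-4), of k] eq by simp
  also have "\<dots> = s [^] Suc m \<otimes> (s [^] k \<otimes> a \<otimes> t [^] k)"
    unfolding l nat_pow_mult[OF assms(2), symmetric] using assms(1-3)
    by (simp add: m_assoc del: nat_pow_Suc)
  finally show ?thesis
    using pow_sandwich[OF assms(1-4), of k] by metis
qed

lemma stable_right:
  assumes "a \<in> carrier G" "s \<in> carrier G" "t \<in> carrier G" "s \<otimes> a \<otimes> t = a"
    and fin: "finite {z \<in> carrier G. divs z a}"
  shows "\<exists>m::nat. a \<otimes> t [^] Suc m = a"
proof -
  have "divs (a \<otimes> t [^] k) a" for k :: nat
    unfolding divs_def using pow_sandwich[OF assms(1-4), of k] assms(1-3)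
    by (intro bexI[of _ "s [^] k"] bexI[of _ \<one>]) (auto simp: m_assoc)
  then have "range (\<lambda>k::nat. a \<otimes> t [^] k) \<subseteq> {z \<in> carrier G. divs z a}"
    using assms(1,3) by auto
  then have "\<not> inj (\<lambda>k::nat. a \<otimes> t [^] k)"
    using fin infinite_UNIV_nat by (meson finite_imageD finite_subset)
  then obtain k l :: nat where "k < l" and eq: "a \<otimes> t [^] k = a \<otimes> t [^] l"
    unfolding inj_def by (metis linorder_neqE_nat)
  then obtain m where l: "l = k + Suc m"
    by (metis add_Suc_right less_imp_Suc_add)
  have "a = s [^] k \<otimes> (a \<otimes> t [^] l)"
    using pow_sandwich[OF assms(1-4), of k] eq assms(1-3) by (simp add: m_assoc)
  also have "\<dots> = s [^] k \<otimes> a \<otimes> t [^] k \<otimes> t [^] Suc m"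
    unfolding l nat_pow_mult[OF assms(3), symmetric] using assms(1-3)
    by (simp add: m_assoc del: nat_pow_Suc)
  finally show ?thesis
    using pow_sandwich[OF assms(1-4), of k] by metis
qed

text \<open>If \<open>u \<otimes> a \<otimes> v\<close> is still above \<open>a\<close>, then
  \<open>u\<close> and \<open>v\<close> are part of a sandwich that fixes \<open>a\<close>, and
  stability undoes its two sides separately. In Green's terms, \<open>u \<otimes> a\<close> is
  L-related and \<open>a \<otimes> v\<close> is R-related to \<open>a\<close>.\<close>

lemma divs_cancel:
  assumes a: "a \<in> carrier G" and u: "u \<in> carrier G" and v: "v \<in> carrier G"
    and fin: "finite {z \<in> carrier G. divs z a}"
    and "divs (u \<otimes> a \<otimes> v) a"
  shows "\<exists>s\<in>carrier G. s \<otimes> u \<otimes> a = a" "\<exists>t\<in>carrier G. a \<otimes> v \<otimes> t = a"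
proof -
  obtain x y where xy: "x \<in> carrier G" "y \<in> carrier G" "x \<otimes> (u \<otimes> a \<otimes> v) \<otimes> y = a"
    using assms(5) unfolding divs_def by blast
  have sand: "(x \<otimes> u) \<otimes> a \<otimes> (v \<otimes> y) = a"
    using xy a u v by (simp add: m_assoc)
  obtain m :: nat where "(x \<otimes> u) [^] Suc m \<otimes> a = a"
    using stable_left[OF a _ _ sand fin] xy u v by auto
  then have "((x \<otimes> u) [^] m \<otimes> x) \<otimes> u \<otimes> a = a"
    using xy u a by (simp add: m_assoc)
  then show "\<exists>s\<in>carrier G. s \<otimes> u \<otimes> a = a"
    using xy u by blast
  obtain k :: nat where "a \<otimes> (v \<otimes> y) [^] Suc k = a"
    using stable_right[OF a _ _ sand fin] xy u v by auto
  then have "a \<otimes> v \<otimes> (y \<otimes> (v \<otimes> y) [^] k) = a"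
    unfolding nat_pow_Suc2[OF m_closed[OF v xy(2)]] using xy v a by (simp add: m_assoc)
  then show "\<exists>t\<in>carrier G. a \<otimes> v \<otimes> t = a"
    using xy v by blast
qed

text \<open>The local condition \<open>fin\<close> takes the place of finiteness of the monoid and
  supplies stability at each \<open>a q\<close>. By \<open>comm\<close> and \<open>inv\<close>,
  \<open>p q\<close> acts on \<open>a q\<close> as an involution that can be moved to either side;
  this produces a nontrivial pair above each \<open>a q\<close>.\<close>

theorem antichain_generators:
  assumes a: "\<And>q. q \<in> Q \<Longrightarrow> a q \<in> carrier G"
    and p: "\<And>q. q \<in> Q \<Longrightarrow> p q \<in> carrier G"
    and comm: "\<And>q. q \<in> Q \<Longrightarrow> p q \<otimes> a q = a q \<otimes> p q"
    and inv: "\<And>q. q \<in> Q \<Longrightarrow> p q \<otimes> (p q \<otimes> a q) = a q"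
    and neq: "\<And>q. q \<in> Q \<Longrightarrow> p q \<otimes> a q \<noteq> a q"
    and fin: "\<And>q. q \<in> Q \<Longrightarrow> finite {z \<in> carrier G. divs z (a q)}"
    and anti: "\<And>q r. q \<in> Q \<Longrightarrow> r \<in> Q \<Longrightarrow> divs (a q) (a r) \<Longrightarrow> q = r"
  shows "\<exists>\<sigma>. monoid_congruence G \<sigma> \<and>
           (\<forall>\<Omega>. generates_congruence G \<Omega> \<sigma> \<longrightarrow> infinite \<Omega> \<or> card \<Omega> \<ge> card Q)"
proof -
  define I where "I = {x \<in> carrier G. \<exists>q\<in>Q. divs (a q) x}"
  \<comment> \<open>The syntactic congruence of the divisor sets of the \<open>a q\<close>, cut down
    to \<open>I\<close> and extended by equality. The cut matters for the counting: both entries of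
    a nontrivial pair lie below some \<open>a s\<close>.\<close>
  define \<sigma> where "\<sigma> = {(x, y). x \<in> carrier G \<and> y \<in> carrier G \<and> (x = y \<or> x \<in> I \<and> y \<in> I \<and>
    (\<forall>q\<in>Q. \<forall>u\<in>carrier G. \<forall>v\<in>carrier G.
      divs (u \<otimes> x \<otimes> v) (a q) \<longleftrightarrow> divs (u \<otimes> y \<otimes> v) (a q)))}"
  have \<sigma>I: "(x, y) \<in> \<sigma> \<longleftrightarrow> x \<in> carrier G \<and> y \<in> carrier G \<and> (x = y \<or> x \<in> I \<and> y \<in> I \<and>
    (\<forall>q\<in>Q. \<forall>u\<in>carrier G. \<forall>v\<in>carrier G.
      divs (u \<otimes> x \<otimes> v) (a q) \<longleftrightarrow> divs (u \<otimes> y \<otimes> v) (a q)))" for x y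
    unfolding \<sigma>_def by simp
  have ideal: "c \<otimes> x \<in> I \<and> x \<otimes> c \<in> I" if "x \<in> I" "c \<in> carrier G" for x c
    using that divs_mult[of x c] divs_trans[of "a _" x] a unfolding I_def by blast
  have \<sigma>_divs: "divs x (a q) \<longleftrightarrow> divs y (a q)" if "(x, y) \<in> \<sigma>" "q \<in> Q" for x y q
    using that unfolding \<sigma>I by (metis one_closed l_one r_one)
  have left: "(c \<otimes> x, c \<otimes> y) \<in> \<sigma>" if xy: "(x, y) \<in> \<sigma>" and c: "c \<in> carrier G" for x y c
  proof (cases "x = y")
    case False
    have "u \<otimes> (c \<otimes> z) \<otimes> v = (u \<otimes> c) \<otimes> z \<otimes> v"
      if "u \<in> carrier G" "v \<in> carrier G" "z \<in> carrier G" for u v z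
      using that c by (simp add: m_assoc)
    then show ?thesis using False xy c ideal unfolding \<sigma>I by auto
  qed (use that in \<open>auto simp: \<sigma>I\<close>)
  have right: "(x \<otimes> c, y \<otimes> c) \<in> \<sigma>" if xy: "(x, y) \<in> \<sigma>" and c: "c \<in> carrier G" for x y c
  proof (cases "x = y")
    case False
    have "u \<otimes> (z \<otimes> c) \<otimes> v = u \<otimes> z \<otimes> (c \<otimes> v)"
      if "u \<in> carrier G" "v \<in> carrier G" "z \<in> carrier G" for u v z
      using that c by (simp add: m_assoc)
    then show ?thesis using False xy c ideal unfolding \<sigma>I by auto
  qed (use that in \<open>auto simp: \<sigma>I\<close>)
  have sym: "(y, x) \<in> \<sigma>" if "(x, y) \<in> \<sigma>" for x y
    using that unfolding \<sigma>I by blast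
  have trans: "(x, z) \<in> \<sigma>" if "(x, y) \<in> \<sigma>" "(y, z) \<in> \<sigma>" for x y z
    using that unfolding \<sigma>I by (elim conjE disjE) simp_all
  have sub: "\<sigma> \<subseteq> carrier G \<times> carrier G" and refl: "\<And>x. x \<in> carrier G \<Longrightarrow> (x, x) \<in> \<sigma>"
    unfolding \<sigma>_def by auto
  have cong: "monoid_congruence G \<sigma>"
    using sub refl sym trans left right by (rule monoid_congruenceI)
  \<comment> \<open>Testing \<open>x\<close> alone suffices, since related elements divide
    \<open>a q\<close> together; products stay inside because the non-divisors of \<open>a q\<close>
    form an ideal.\<close>
  define \<sigma>' where "\<sigma>' q = {(x, y) \<in> \<sigma>. x = y \<or> \<not> divs x (a q)}" for q
  have cong': "monoid_congruence G (\<sigma>' q)" if q: "q \<in> Q" for q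
  proof -
    have "(y, x) \<in> \<sigma>' q" if "(x, y) \<in> \<sigma>' q" for x y
      using that sym[of x y] \<sigma>_divs[of x y q] q unfolding \<sigma>'_def by auto
    moreover have "(x, z) \<in> \<sigma>' q" if "(x, y) \<in> \<sigma>' q" "(y, z) \<in> \<sigma>' q" for x y z
      using that trans[of x y z] \<sigma>_divs[of x y q] q unfolding \<sigma>'_def by auto
    moreover have "(c \<otimes> x, c \<otimes> y) \<in> \<sigma>' q \<and> (x \<otimes> c, y \<otimes> c) \<in> \<sigma>' q"
      if "(x, y) \<in> \<sigma>' q" "c \<in> carrier G" for x y c
      using that left[of x y c] right[of x y c] divs_mult[of x c] sub divs_trans[of x _ "a q"]
      unfolding \<sigma>'_def by blast
    moreover have "\<sigma>' q \<subseteq> carrier G \<times> carrier G" "\<And>x. x \<in> carrier G \<Longrightarrow> (x, x) \<in> \<sigma>' q"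
      using sub refl unfolding \<sigma>'_def by auto
    ultimately show ?thesis
      by (intro monoid_congruenceI) blast+
  qed
  have pair: "(a q, p q \<otimes> a q) \<in> \<sigma>" if q: "q \<in> Q" for q
  proof -
    let ?a = "a q" and ?p = "p q" and ?b = "p q \<otimes> a q"
    note c = a[OF q] p[OF q]
    have "divs (u \<otimes> ?a \<otimes> v) (a r) \<longleftrightarrow> divs (u \<otimes> ?b \<otimes> v) (a r)"
      if r: "r \<in> Q" and u: "u \<in> carrier G" and v: "v \<in> carrier G" for r u v
    proof
      assume d: "divs (u \<otimes> ?a \<otimes> v) (a r)"
      have "divs ?a (a r)"
        using divs_trans[OF _ d] u v c unfolding divs_def by blast
      then have "r = q" using anti q r by blast
      with d obtain s t where s: "s \<in> carrier G" "s \<otimes> u \<otimes> ?a = ?a"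
        and t: "t \<in> carrier G" "?a \<otimes> v \<otimes> t = ?a"
        using divs_cancel[OF c(1) u v fin[OF q]] by blast
      \<comment> \<open>Writing \<open>?b\<close> as \<open>?a \<otimes> ?p\<close> exposes
        \<open>s \<otimes> u \<otimes> ?a\<close>, which collapses to \<open>?a\<close>; the extra
        \<open>?p\<close> on the left then cancels the one to the right of
        \<open>?a\<close>.\<close>
      have "(?p \<otimes> s) \<otimes> (u \<otimes> ?b \<otimes> v) \<otimes> t = ?p \<otimes> (s \<otimes> u \<otimes> ?a) \<otimes> ?p \<otimes> v \<otimes> t"
        unfolding comm[OF q] using s(1) t(1) u v c by (simp add: m_assoc)
      also have "\<dots> = ?p \<otimes> ?b \<otimes> v \<otimes> t"
        unfolding s(2) m_assoc[OF c(2) c(1) c(2)] comm[OF q, symmetric] ..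
      also have "\<dots> = ?a"
        unfolding inv[OF q] t(2) ..
      finally show "divs (u \<otimes> ?b \<otimes> v) (a r)"
        unfolding \<open>r = q\<close> divs_def using s(1) t(1) c by blast
    next
      assume d: "divs (u \<otimes> ?b \<otimes> v) (a r)"
      \<comment> \<open>Absorbing \<open>?p\<close> on the right, as here, allows \<open>u\<close>
        to be cancelled; absorbing it on the left, as in \<open>e2\<close>, allows \<open>v\<close>
        to be cancelled.\<close>
      have e1: "u \<otimes> ?b \<otimes> v = u \<otimes> ?a \<otimes> (?p \<otimes> v)"
        unfolding comm[OF q] using u v c by (simp add: m_assoc)
      have e2: "u \<otimes> ?b \<otimes> v = (u \<otimes> ?p) \<otimes> ?a \<otimes> v"
        using u v c by (simp add: m_assoc)
      have "divs ?a (a r)"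
        using divs_trans[OF _ d[unfolded e2] c(1)] u v c unfolding divs_def by blast
      then have "r = q" using anti q r by blast
      obtain s where s: "s \<in> carrier G" "s \<otimes> u \<otimes> ?a = ?a"
        using divs_cancel(1)[OF c(1) u _ fin[OF q]] d c v unfolding e1 \<open>r = q\<close> by blast
      obtain t where t: "t \<in> carrier G" "?a \<otimes> v \<otimes> t = ?a"
        using divs_cancel(2)[OF c(1) _ v fin[OF q]] d c u unfolding e2 \<open>r = q\<close> by blast
      have "s \<otimes> (u \<otimes> ?a \<otimes> v) \<otimes> t = (s \<otimes> u \<otimes> ?a) \<otimes> v \<otimes> t"
        using s(1) t(1) u v c by (simp add: m_assoc)
      also have "\<dots> = ?a"
        unfolding s(2) t(2) ..
      finally show "divs (u \<otimes> ?a \<otimes> v) (a r)"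
        unfolding \<open>r = q\<close> divs_def using s(1) t(1) by blast
    qed
    moreover have "?a \<in> I" using q c divs_refl unfolding I_def by blast
    moreover have "?b \<in> I" using ideal \<open>?a \<in> I\<close> c by blast
    ultimately show ?thesis unfolding \<sigma>I using c by blast
  qed
  have "infinite \<Omega> \<or> card \<Omega> \<ge> card Q" if gen: "generates_congruence G \<Omega> \<sigma>" for \<Omega>
  proof -
    have "\<Omega> \<subseteq> \<sigma>" and least: "\<And>\<tau>. monoid_congruence G \<tau> \<Longrightarrow> \<Omega> \<subseteq> \<tau> \<Longrightarrow> \<sigma> \<subseteq> \<tau>"
      using gen unfolding generates_congruence_def by auto
    have "\<exists>w\<in>\<Omega>. fst w \<in> I \<and> divs (fst w) (a q)" if q: "q \<in> Q" for q
    proof -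
      have "(a q, p q \<otimes> a q) \<notin> \<sigma>' q"
        using neq[OF q] divs_refl[OF a[OF q]] unfolding \<sigma>'_def by auto
      then have "\<not> \<Omega> \<subseteq> \<sigma>' q"
        using least[OF cong'[OF q]] pair[OF q] by blast
      then obtain x y where "(x, y) \<in> \<Omega>" "(x, y) \<notin> \<sigma>' q" by auto
      then have "(x, y) \<in> \<Omega>" "x \<in> I" "divs x (a q)"
        using \<open>\<Omega> \<subseteq> \<sigma>\<close> unfolding \<sigma>'_def by (auto simp: \<sigma>I)
      then show ?thesis by force
    qed
    then obtain w where w: "\<And>q. q \<in> Q \<Longrightarrow> w q \<in> \<Omega> \<and> fst (w q) \<in> I \<and> divs (fst (w q)) (a q)"
      by metis
    have "inj_on w Q"
    proof (rule inj_onI)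
      fix q r assume qr: "q \<in> Q" "r \<in> Q" "w q = w r"
      \<comment> \<open>The shared entry lies below some \<open>a s\<close> and above both
        \<open>a q\<close> and \<open>a r\<close>, so the antichain condition identifies all three
        indices.\<close>
      obtain s where s: "s \<in> Q" "divs (a s) (fst (w q))"
        using w[OF qr(1)] unfolding I_def by blast
      have "s = q" using anti[OF s(1) qr(1)] divs_trans[OF s(2)] w[OF qr(1)] a[OF s(1)] by blast
      moreover have "s = r"
        using anti[OF s(1) qr(2)] divs_trans[OF s(2)] w[OF qr(2)] qr(3) a[OF s(1)] by metis
      ultimately show "q = r" by simp
    qed
    moreover have "w ` Q \<subseteq> \<Omega>" using w by auto
    ultimately show ?thesis using card_inj_on_le by blast
  qed
  then show ?thesis using cong by blast
qed

end

section \<open>A faithful matrix representation of the twisted partition monoid\<close>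

definition colour :: "nat set \<Rightarrow> nat set \<Rightarrow> vertex set" where
  "colour f g = Upper ` f \<union> Lower ` g"

definition block_constant :: "vertex set set \<Rightarrow> nat set \<Rightarrow> nat set \<Rightarrow> bool" where
  "block_constant \<alpha> f g \<longleftrightarrow> (\<forall>A\<in>\<alpha>. \<forall>x\<in>A. \<forall>y\<in>A. x \<in> colour f g \<longleftrightarrow> y \<in> colour f g)"

lemma colour_iff [simp]:
  "Upper i \<in> colour f g \<longleftrightarrow> i \<in> f" "Lower i \<in> colour f g \<longleftrightarrow> i \<in> g" "Mid i \<notin> colour f g"
  unfolding colour_def by auto

lemma points_iff [simp]:
  "Upper i \<in> points n \<longleftrightarrow> i \<in> {1..n}" "Lower i \<in> points n \<longleftrightarrow> i \<in> {1..n}" "Mid i \<notin> points n"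
  unfolding points_def by auto

lemma mids_iff [simp]: "Mid i \<in> mids n \<longleftrightarrow> i \<in> {1..n}" "Upper i \<notin> mids n" "Lower i \<notin> mids n"
  unfolding mids_def by auto

lemma block_subset: "\<alpha> \<in> partitions n \<Longrightarrow> A \<in> \<alpha> \<Longrightarrow> A \<subseteq> points n"
  unfolding partitions_def partition_on_def by auto

text \<open>Pulled back along \<open>lower_to_mid\<close>, the joint colouring becomes
  \<open>colour f h\<close>; along \<open>upper_to_mid\<close> it becomes \<open>colour h g\<close>.
  Constancy on blocks is therefore invariance along edges.\<close>

lemma block_constant_product_graph:
  assumes "\<alpha> \<in> partitions n" "\<beta> \<in> partitions n"
  shows "block_constant \<alpha> f h \<and> block_constant \<beta> h g \<longleftrightarrow>
    (\<forall>(x, y)\<in>product_graph \<alpha> \<beta>. x \<in> colour f g \<union> Mid ` h \<longleftrightarrow> y \<in> colour f g \<union> Mid ` h)"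
    (is "_ \<longleftrightarrow> ?R")
proof -
  let ?Y = "colour f g \<union> Mid ` h"
  have low: "lower_to_mid v \<in> ?Y \<longleftrightarrow> v \<in> colour f h" if "v \<in> points n" for v
    using that by (cases v) auto
  have upp: "upper_to_mid v \<in> ?Y \<longleftrightarrow> v \<in> colour h g" if "v \<in> points n" for v
    using that by (cases v) auto
  have gen: "(\<forall>(x, y)\<in>{(x, y). \<exists>A\<in>S. x \<in> k ` A \<and> y \<in> k ` A}. P x \<longleftrightarrow> P y) \<longleftrightarrow>
    (\<forall>A\<in>S. \<forall>x\<in>A. \<forall>y\<in>A. P (k x) \<longleftrightarrow> P (k y))"
    for S and k :: "vertex \<Rightarrow> vertex" and P
    by (simp add: split_paired_all) blast
  have "?R \<longleftrightarrow> (\<forall>A\<in>\<alpha>. \<forall>x\<in>A. \<forall>y\<in>A. lower_to_mid x \<in> ?Y \<longleftrightarrow> lower_to_mid y \<in> ?Y) \<and>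
    (\<forall>A\<in>\<beta>. \<forall>x\<in>A. \<forall>y\<in>A. upper_to_mid x \<in> ?Y \<longleftrightarrow> upper_to_mid y \<in> ?Y)"
    unfolding product_graph_def ball_Un unfolding gen ..
  also have "\<dots> \<longleftrightarrow> block_constant \<alpha> f h \<and> block_constant \<beta> h g"
    unfolding block_constant_def
    by (intro arg_cong2[where f="(\<and>)"] ball_cong refl arg_cong2[where f="(=)"]
        low[OF subsetD[OF block_subset[OF assms(1)]]] upp[OF subsetD[OF block_subset[OF assms(2)]]])
  finally show ?thesis by blast
qed

lemma invariant_rtrancl:
  "(\<forall>(x, y)\<in>r. P x \<longleftrightarrow> P y) \<longleftrightarrow> (\<forall>(x, y)\<in>r\<^sup>*. P x \<longleftrightarrow> P y)"
proof
  assume *: "\<forall>(x, y)\<in>r. P x \<longleftrightarrow> P y"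
  have "P x \<longleftrightarrow> P y" if "(x, y) \<in> r\<^sup>*" for x y
    using that by induction (use * in auto)
  then show "\<forall>(x, y)\<in>r\<^sup>*. P x \<longleftrightarrow> P y" by blast
qed auto

lemma sym_product_graph: "sym (product_graph \<alpha> \<beta>)"
  unfolding product_graph_def sym_def by blast

lemma product_graph_subset:
  assumes "\<alpha> \<in> partitions n" "\<beta> \<in> partitions n" "(x, y) \<in> product_graph \<alpha> \<beta>"
  shows "y \<in> points n \<union> mids n"
proof -
  have "lower_to_mid v \<in> points n \<union> mids n" "upper_to_mid v \<in> points n \<union> mids n"
    if "v \<in> points n" for v
    using that by (cases v; simp)+
  then show ?thesis
    using assms block_subset unfolding product_graph_def by blast
qed

lemma connected_subset:
  assumes "\<alpha> \<in> partitions n" "\<beta> \<in> partitions n" "(x, y) \<in> (product_graph \<alpha> \<beta>)\<^sup>*"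
    "x \<in> points n \<union> mids n"
  shows "y \<in> points n \<union> mids n"
  using assms(3,4) by induction (use product_graph_subset[OF assms(1,2)] in blast)+

text \<open>The closure is taken on the whole vertex type, hence \<open>UNIV\<close>; vertices
  outside the graph only form singleton classes by \<open>connected_subset\<close>.\<close>

lemma equiv_connected: "equiv UNIV ((product_graph \<alpha> \<beta>)\<^sup>*)"
  using sym_product_graph by (intro equivI) (auto simp: refl_rtrancl trans_rtrancl sym_rtrancl)

lemma same_component:
  assumes "x \<in> points n \<union> mids n"
  shows "(\<exists>C\<in>product_components n \<alpha> \<beta>. x \<in> C \<and> y \<in> C) \<longleftrightarrow> (x, y) \<in> (product_graph \<alpha> \<beta>)\<^sup>*"
  (is "?L \<longleftrightarrow> (x, y) \<in> ?E")
proof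
  assume ?L
  then obtain z where "(z, x) \<in> ?E" "(z, y) \<in> ?E"
    unfolding product_components_def quotient_def by auto
  then show "(x, y) \<in> ?E"
    using equiv_connected by (metis equivE symD transD)
next
  assume "(x, y) \<in> ?E"
  then show ?L
    using assms unfolding product_components_def by (intro bexI[OF _ quotientI[of x]]) auto
qed

lemma block_constant_quotient:
  assumes "equiv (points n) S"
  shows "block_constant (points n // S) f g \<longleftrightarrow> (\<forall>(x, y)\<in>S. x \<in> colour f g \<longleftrightarrow> y \<in> colour f g)"
proof
  assume *: "block_constant (points n // S) f g"
  have "x \<in> colour f g \<longleftrightarrow> y \<in> colour f g" if "(x, y) \<in> S" for x y
  proof -
    have "x \<in> points n" using that assms unfolding equiv_def by blast
    then have "S `` {x} \<in> points n // S" "x \<in> S `` {x}" "y \<in> S `` {x}"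
      using that equiv_class_self[OF assms] by (auto intro: quotientI)
    then show ?thesis using * unfolding block_constant_def by blast
  qed
  then show "\<forall>(x, y)\<in>S. x \<in> colour f g \<longleftrightarrow> y \<in> colour f g" by blast
next
  assume "\<forall>(x, y)\<in>S. x \<in> colour f g \<longleftrightarrow> y \<in> colour f g"
  then show "block_constant (points n // S) f g"
    unfolding block_constant_def quotient_def by blast
qed

text \<open>Both claims follow once the product is recognised as the quotient of
  \<open>points n\<close> by connectivity restricted to the outer vertices.\<close>

lemma partition_mult_closed: "partition_mult n \<alpha> \<beta> \<in> partitions n"
  and block_constant_partition_mult_iff_connected:
    "block_constant (partition_mult n \<alpha> \<beta>) f g \<longleftrightarrow>
      (\<forall>x\<in>points n. \<forall>y\<in>points n. (x, y) \<in> (product_graph \<alpha> \<beta>)\<^sup>* \<longrightarrow>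
        (x \<in> colour f g \<longleftrightarrow> y \<in> colour f g))"
proof -
  define S where "S = {(x, y) \<in> points n \<times> points n. (x, y) \<in> (product_graph \<alpha> \<beta>)\<^sup>*}"
  have "(x, y) \<in> {(x, y) \<in> points n \<times> points n. \<exists>C\<in>product_components n \<alpha> \<beta>. x \<in> C \<and> y \<in> C}
      \<longleftrightarrow> (x, y) \<in> S" for x y
    using same_component[of x n \<alpha> \<beta> y] unfolding S_def by (cases "x \<in> points n") simp_all
  then have mult: "partition_mult n \<alpha> \<beta> = points n // S"
    unfolding partition_mult_def by (intro arg_cong2[where f="(//)"]) auto
  have S: "equiv (points n) S"
  proof (rule equivI)
    show "sym S" "trans S"
      using equiv_connected[of \<alpha> \<beta>] unfolding S_def equiv_def sym_def trans_def by blast+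
  qed (auto simp: S_def refl_on_def)
  show "partition_mult n \<alpha> \<beta> \<in> partitions n"
    unfolding mult partitions_def using partition_on_quotient S by blast
  show "block_constant (partition_mult n \<alpha> \<beta>) f g \<longleftrightarrow>
      (\<forall>x\<in>points n. \<forall>y\<in>points n. (x, y) \<in> (product_graph \<alpha> \<beta>)\<^sup>* \<longrightarrow>
        (x \<in> colour f g \<longleftrightarrow> y \<in> colour f g))"
    unfolding mult block_constant_quotient[OF S] unfolding S_def by blast
qed

text \<open>A colouring of the outer vertices that is constant on the blocks of the product forces the
  colour of every middle vertex, except that floating components may be coloured freely.\<close>

lemma card_middle_colourings:
  assumes \<alpha>: "\<alpha> \<in> partitions n" and \<beta>: "\<beta> \<in> partitions n"
    and fg: "f \<subseteq> {1..n}" "g \<subseteq> {1..n}"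
  shows "card {h \<in> Pow {1..n}. block_constant \<alpha> f h \<and> block_constant \<beta> h g} =
    (if block_constant (partition_mult n \<alpha> \<beta>) f g then 2 ^ floating n \<alpha> \<beta> else 0)"
proof -
  let ?V = "points n \<union> mids n"
  define E where "E = (product_graph \<alpha> \<beta>)\<^sup>*"
  define F where "F = {C \<in> product_components n \<alpha> \<beta>. C \<subseteq> mids n}"
  define H where "H = {h \<in> Pow {1..n}. block_constant \<alpha> f h \<and> block_constant \<beta> h g}"
  have E: "equiv UNIV E" unfolding E_def by (rule equiv_connected)
  have Erefl: "(x, x) \<in> E" for x unfolding E_def by simp
  have Esym: "(y, x) \<in> E" if "(x, y) \<in> E" for x y using E that by (meson equivE symD)
  have Etrans: "(x, z) \<in> E" if "(x, y) \<in> E" "(y, z) \<in> E" for x y z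
    using that unfolding E_def by simp
  have EV: "y \<in> ?V" if "(x, y) \<in> E" "x \<in> ?V" for x y
    using that connected_subset[OF \<alpha> \<beta>] unfolding E_def by blast
  have H: "h \<in> H \<longleftrightarrow> h \<subseteq> {1..n} \<and>
      (\<forall>(x, y)\<in>E. x \<in> colour f g \<union> Mid ` h \<longleftrightarrow> y \<in> colour f g \<union> Mid ` h)" for h
    unfolding H_def E_def invariant_rtrancl[symmetric] using block_constant_product_graph[OF \<alpha> \<beta>] by auto
  have Hinv: "x \<in> colour f g \<union> Mid ` h \<longleftrightarrow> y \<in> colour f g \<union> Mid ` h"
    if "h \<in> H" "(x, y) \<in> E" for h x y
    using that unfolding H by blast
  have col: "colour f g \<subseteq> points n"
    using fg unfolding colour_def points_def by blast
  have disj: "x \<notin> mids n" if "x \<in> points n" for x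
    using that by (cases x) auto
  have block_constant: "block_constant (partition_mult n \<alpha> \<beta>) f g \<longleftrightarrow>
      (\<forall>x\<in>points n. \<forall>y\<in>points n. (x, y) \<in> E \<longrightarrow> (x \<in> colour f g \<longleftrightarrow> y \<in> colour f g))"
    unfolding E_def by (rule block_constant_partition_mult_iff_connected)
  have F: "C \<in> F \<longleftrightarrow> C \<subseteq> mids n \<and> (\<exists>x\<in>mids n. C = E `` {x})" for C
    unfolding F_def product_components_def E_def[symmetric] quotient_def using Erefl by auto
  have Fmids: "C \<subseteq> mids n" if "C \<in> F" for C
    using that unfolding F_def by blast
  have Fcl: "y \<in> C" if "C \<in> F" "x \<in> C" "(x, y) \<in> E" for C x y
    using that Etrans unfolding F by blast
  show ?thesis
  proof (cases "block_constant (partition_mult n \<alpha> \<beta>) f g")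
    case False
    \<comment> \<open>An admissible middle colouring would give a set invariant under
      \<open>E\<close> whose trace on the outer vertices is \<open>colour f g\<close>.\<close>
    have "H = {}"
    proof (rule ccontr)
      assume "H \<noteq> {}"
      then obtain h where "h \<in> H" by blast
      have "x \<in> colour f g \<union> Mid ` h \<longleftrightarrow> x \<in> colour f g" if "x \<in> points n" for x
        using that by (cases x) auto
      then have "block_constant (partition_mult n \<alpha> \<beta>) f g"
        unfolding block_constant using Hinv[OF \<open>h \<in> H\<close>] by blast
      then show False using False by blast
    qed
    then show ?thesis using False unfolding H_def by simp
  next
    case True
    then have colour_connected: "x \<in> colour f g \<longleftrightarrow> y \<in> colour f g"
      if "x \<in> points n" "y \<in> points n" "(x, y) \<in> E" for x y
      using that unfolding block_constant by blast
    \<comment> \<open>\<open>base\<close> collects the middle vertices whose colour is forced by a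
      coloured outer vertex. \<open>up\<close> and \<open>down\<close> are inverse bijections
      between admissible middle colourings and sets of floating components.\<close>
    define base where "base = {i \<in> {1..n}. \<exists>x\<in>colour f g. (x, Mid i) \<in> E}"
    define up where "up h = {C \<in> F. C \<subseteq> Mid ` h}" for h
    define down where "down K = base \<union> {i. Mid i \<in> \<Union>K}" for K
    have Mid_base: "Mid i \<in> C \<Longrightarrow> C \<in> F \<Longrightarrow> i \<notin> base" for i C
      using Fcl Esym col disj unfolding base_def F by blast
    have down_H: "down K \<in> H" if K: "K \<subseteq> F" for K
    proof -
      have down_n: "down K \<subseteq> {1..n}"
        using K Fmids mids_iff(1)[of _ n] unfolding down_def base_def by blast
      have mem: "x \<in> colour f g \<union> Mid ` down K \<longleftrightarrow> (\<exists>z\<in>colour f g. (z, x) \<in> E) \<or> x \<in> \<Union>K"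
        if "x \<in> ?V" for x
      proof (cases "x \<in> points n")
        case True
        have "x \<notin> \<Union>K" using True K Fmids disj by blast
        moreover have "x \<notin> Mid ` down K" using True by auto
        moreover have "x \<in> colour f g \<longleftrightarrow> (\<exists>z\<in>colour f g. (z, x) \<in> E)"
          using True col Erefl colour_connected by blast
        ultimately show ?thesis by blast
      next
        case False
        then obtain i where "x = Mid i" "i \<in> {1..n}" using \<open>x \<in> ?V\<close> by (auto simp: mids_def)
        then show ?thesis unfolding down_def base_def by auto
      qed
      have "x \<in> colour f g \<union> Mid ` down K \<longleftrightarrow> y \<in> colour f g \<union> Mid ` down K"
        if xy: "(x, y) \<in> E" for x y
      proof (cases "x \<in> ?V")
        case True
        then have "y \<in> ?V" using EV xy by blast
        have "x \<in> \<Union>K \<longleftrightarrow> y \<in> \<Union>K"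
          using Fcl K xy Esym[OF xy] by blast
        then show ?thesis
          unfolding mem[OF True] mem[OF \<open>y \<in> ?V\<close>] using Etrans xy Esym[OF xy] by blast
      next
        case False
        then have "y \<notin> ?V" using EV Esym[OF xy] by blast
        moreover have "colour f g \<union> Mid ` down K \<subseteq> ?V"
          using col down_n by (auto simp: mids_def)
        ultimately show ?thesis using False by blast
      qed
      then show ?thesis unfolding H using down_n by blast
    qed
    have "bij_betw up H (Pow F)"
    proof (rule bij_betw_byWitness[of _ down])
      show "\<forall>h\<in>H. down (up h) = h"
      proof
        fix h assume h: "h \<in> H"
        have "i \<in> h" if i: "i \<in> base" for i
        proof -
          obtain x where "x \<in> colour f g" "(x, Mid i) \<in> E" using i unfolding base_def by blast
          then have "Mid i \<in> colour f g \<union> Mid ` h" using Hinv[OF h] by blast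
          then show ?thesis by auto
        qed
        moreover have "i \<in> h" if "Mid i \<in> \<Union>(up h)" for i
          using that unfolding up_def by auto
        \<comment> \<open>Either the component of \<open>Mid i\<close> floats and is coloured
          throughout, or it reaches an outer vertex, which is then coloured and puts
          \<open>i\<close> into \<open>base\<close>.\<close>
        moreover have "i \<in> base \<or> Mid i \<in> \<Union>(up h)" if "i \<in> h" for i
        proof (cases "E `` {Mid i} \<subseteq> mids n")
          case True
          then have "E `` {Mid i} \<in> F"
            using that h unfolding F H by (auto intro!: bexI[of _ "Mid i"])
          moreover have "E `` {Mid i} \<subseteq> Mid ` h"
          proof
            fix y assume "y \<in> E `` {Mid i}"
            then have "y \<in> colour f g \<union> Mid ` h" "y \<in> mids n"
              using Hinv[OF h, of "Mid i" y] that True by auto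
            then show "y \<in> Mid ` h" using col disj by blast
          qed
          ultimately show ?thesis unfolding up_def using Erefl[of "Mid i"] by blast
        next
          case False
          then obtain y where y: "(Mid i, y) \<in> E" "y \<notin> mids n" by blast
          have "i \<in> {1..n}" using h that unfolding H by blast
          moreover have "y \<in> colour f g \<union> Mid ` h"
            using Hinv[OF h y(1)] that by auto
          then have "y \<in> colour f g"
            using y(2) h unfolding H by (auto simp: mids_def)
          ultimately show ?thesis unfolding base_def using Esym[OF y(1)] by blast
        qed
        ultimately show "down (up h) = h" unfolding down_def by blast
      qed
      show "\<forall>K\<in>Pow F. up (down K) = K"
      proof
        fix K assume "K \<in> Pow F"
        then have K: "K \<subseteq> F" by blast
        \<comment> \<open>A floating component avoids \<open>base\<close>, so if it is covered by
          \<open>down K\<close> it meets, and hence equals, a member of \<open>K\<close>.\<close>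
        have "C \<in> K" if C: "C \<in> F" "C \<subseteq> Mid ` down K" for C
        proof -
          obtain x where x: "x \<in> mids n" "C = E `` {x}" using C(1) unfolding F by blast
          then obtain i where i: "x = Mid i" unfolding mids_def by blast
          have "Mid i \<in> C" using x i Erefl by blast
          then have "Mid i \<in> \<Union>K" using C Mid_base unfolding down_def by blast
          then obtain D where D: "D \<in> K" "Mid i \<in> D" by blast
          then obtain z where "D = E `` {z}" using K F by blast
          then have "D = E `` {Mid i}"
            using \<open>Mid i \<in> D\<close> Etrans Esym by blast
          then show ?thesis using D x i by blast
        qed
        moreover have "C \<subseteq> Mid ` down K" if C: "C \<in> K" for C
        proof
          fix x assume "x \<in> C"
          then obtain i where "x = Mid i" using Fmids K C unfolding mids_def by blast
          then show "x \<in> Mid ` down K" using \<open>x \<in> C\<close> C unfolding down_def by blast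
        qed
        ultimately show "up (down K) = K" unfolding up_def using K by blast
      qed
      show "up ` H \<subseteq> Pow F" unfolding up_def by blast
      show "down ` Pow F \<subseteq> H" using down_H by blast
    qed
    then have "card H = card (Pow F)" by (rule bij_betw_same_card)
    moreover have "finite F"
      by (rule finite_subset[of _ "Pow (mids n)"]) (auto simp: F_def mids_def)
    ultimately show ?thesis
      using True unfolding H_def floating_def F_def by (simp add: card_Pow)
  qed
qed

text \<open>The Boolean shadow of the count: a power of two never vanishes, so forgetting the twist
  turns the product into relational composition.\<close>

lemma block_constant_partition_mult:
  assumes "\<alpha> \<in> partitions n" "\<beta> \<in> partitions n" "f \<subseteq> {1..n}" "g \<subseteq> {1..n}"
  shows "block_constant (partition_mult n \<alpha> \<beta>) f g \<longleftrightarrow> (\<exists>h\<subseteq>{1..n}. block_constant \<alpha> f h \<and> block_constant \<beta> h g)"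
proof -
  have "finite {h \<in> Pow {1..n}. block_constant \<alpha> f h \<and> block_constant \<beta> h g}" by simp
  then have "(\<exists>h\<subseteq>{1..n}. block_constant \<alpha> f h \<and> block_constant \<beta> h g) \<longleftrightarrow>
      card {h \<in> Pow {1..n}. block_constant \<alpha> f h \<and> block_constant \<beta> h g} \<noteq> 0"
    unfolding card_eq_0_iff by blast
  then show ?thesis unfolding card_middle_colourings[OF assms] by simp
qed

text \<open>Colour exactly the block \<open>A\<close>. This is constant on the blocks of \<alpha>,
  hence on those of \<beta>, so a block of \<beta> meeting \<open>A\<close> stays inside it.\<close>

lemma block_subset_of_block_constant_eq:
  assumes \<alpha>: "\<alpha> \<in> partitions n" and \<beta>: "\<beta> \<in> partitions n"
    and eq: "\<And>f g. f \<subseteq> {1..n} \<Longrightarrow> g \<subseteq> {1..n} \<Longrightarrow> block_constant \<alpha> f g \<longleftrightarrow> block_constant \<beta> f g"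
    and A: "A \<in> \<alpha>" and B: "B \<in> \<beta>" and x: "x \<in> A" "x \<in> B"
  shows "B \<subseteq> A"
proof -
  define f g where "f = {i. Upper i \<in> A}" and "g = {i. Lower i \<in> A}"
  have sub: "f \<subseteq> {1..n}" "g \<subseteq> {1..n}"
    using block_subset[OF \<alpha> A] unfolding f_def g_def by force+
  have "y \<in> colour f g \<longleftrightarrow> y \<in> A" for y
    using block_subset[OF \<alpha> A] by (cases y) (auto simp: f_def g_def)
  then have col: "colour f g = A" by blast
  have "A' = A \<or> A' \<inter> A = {}" if "A' \<in> \<alpha>" for A'
    using that A \<alpha> unfolding partitions_def partition_on_def disjoint_def by blast
  then have "block_constant \<alpha> f g"
    unfolding block_constant_def col by blast
  then have "block_constant \<beta> f g" using eq sub by blast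
  then show ?thesis using B x unfolding block_constant_def col by blast
qed

lemma partition_eqI:
  assumes \<alpha>: "\<alpha> \<in> partitions n" and \<beta>: "\<beta> \<in> partitions n"
    and eq: "\<And>f g. f \<subseteq> {1..n} \<Longrightarrow> g \<subseteq> {1..n} \<Longrightarrow> block_constant \<alpha> f g \<longleftrightarrow> block_constant \<beta> f g"
  shows "\<alpha> = \<beta>"
proof -
  have "\<alpha> \<subseteq> \<beta>" if \<alpha>: "\<alpha> \<in> partitions n" and \<beta>: "\<beta> \<in> partitions n"
    and eq: "\<And>f g. f \<subseteq> {1..n} \<Longrightarrow> g \<subseteq> {1..n} \<Longrightarrow> block_constant \<alpha> f g \<longleftrightarrow> block_constant \<beta> f g" for \<alpha> \<beta>
  proof
    fix A assume A: "A \<in> \<alpha>"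
    then have "A \<noteq> {}" using \<alpha> unfolding partitions_def partition_on_def by blast
    then obtain x where x: "x \<in> A" by blast
    then have "x \<in> \<Union>\<beta>"
      using block_subset[OF \<alpha> A] \<beta> unfolding partitions_def partition_on_def by blast
    then obtain B where B: "B \<in> \<beta>" "x \<in> B" by blast
    have "B \<subseteq> A" using block_subset_of_block_constant_eq[OF \<alpha> \<beta> eq A B(1) x B(2)] by blast
    moreover have "A \<subseteq> B" using block_subset_of_block_constant_eq[OF \<beta> \<alpha> _ B(1) A B(2) x] eq by blast
    ultimately show "A \<in> \<beta>" using B(1) by simp
  qed
  from this[OF assms] this[OF \<beta> \<alpha>] show ?thesis using eq by blast
qed

section \<open>The twisted product as matrix multiplication\<close>

definition rep :: "nat \<times> vertex set set \<Rightarrow> nat set \<Rightarrow> nat set \<Rightarrow> nat" where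
  "rep x f g = (if block_constant (snd x) f g then 2 ^ fst x else 0)"

lemma twisted_carrier [simp]:
  "x \<in> carrier (twisted_partition_monoid n) \<longleftrightarrow> snd x \<in> partitions n"
  unfolding twisted_partition_monoid_def by (cases x) auto

lemma twisted_mult [simp]:
  "x \<otimes>\<^bsub>twisted_partition_monoid n\<^esub> y =
    (fst x + fst y + floating n (snd x) (snd y), partition_mult n (snd x) (snd y))"
  unfolding twisted_partition_monoid_def by (cases x; cases y) simp

text \<open>All nonzero summands equal \<open>2 ^ (fst x + fst y)\<close>, and
  \<open>card_middle_colourings\<close> counts them.\<close>

lemma rep_mult:
  assumes "snd x \<in> partitions n" "snd y \<in> partitions n" "f \<subseteq> {1..n}" "g \<subseteq> {1..n}"
  shows "rep (x \<otimes>\<^bsub>twisted_partition_monoid n\<^esub> y) f g = (\<Sum>h\<in>Pow {1..n}. rep x f h * rep y h g)"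
proof -
  have "(\<Sum>h\<in>Pow {1..n}. rep x f h * rep y h g) =
      (\<Sum>h\<in>Pow {1..n}. if block_constant (snd x) f h \<and> block_constant (snd y) h g then 2 ^ (fst x + fst y) else 0)"
    by (intro sum.cong) (auto simp: rep_def power_add)
  also have "\<dots> = (\<Sum>h\<in>{h \<in> Pow {1..n}. block_constant (snd x) f h \<and> block_constant (snd y) h g}. 2 ^ (fst x + fst y))"
    by (rule sum.inter_filter[symmetric]) simp
  also have "\<dots> = rep (x \<otimes>\<^bsub>twisted_partition_monoid n\<^esub> y) f g"
    using card_middle_colourings[OF assms] by (simp add: rep_def power_add)
  finally show ?thesis ..
qed

lemma rep_eqI:
  assumes "snd x \<in> partitions n" "snd y \<in> partitions n"
    and eq: "\<And>f g. f \<subseteq> {1..n} \<Longrightarrow> g \<subseteq> {1..n} \<Longrightarrow> rep x f g = rep y f g"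
  shows "x = y"
proof (rule prod_eqI)
  \<comment> \<open>The entry at the empty colourings never vanishes, so it reads off the
    twist.\<close>
  have "block_constant \<alpha> {} {}" for \<alpha>
    unfolding block_constant_def colour_def by simp
  then show "fst x = fst y"
    using eq[of "{}" "{}"] by (simp add: rep_def)
  show "snd x = snd y"
  proof (rule partition_eqI[OF assms(1,2)])
    fix f g assume "f \<subseteq> {1..n}" "g \<subseteq> {1..n}"
    from eq[OF this] show "block_constant (snd x) f g \<longleftrightarrow> block_constant (snd y) f g"
      by (simp add: rep_def split: if_splits)
  qed
qed

lemma partition_one_image: "partition_one n = (\<lambda>i. {Upper i, Lower i}) ` {1..n}"
  unfolding partition_one_def by auto

lemma partition_one: "partition_one n \<in> partitions n"
  unfolding partitions_def partition_on_def partition_one_image disjoint_def points_def by auto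

lemma block_constant_partition_one:
  "f \<subseteq> {1..n} \<Longrightarrow> g \<subseteq> {1..n} \<Longrightarrow> block_constant (partition_one n) f g \<longleftrightarrow> f = g"
  unfolding block_constant_def partition_one_image by auto

lemma rep_one:
  assumes "f \<subseteq> {1..n}" "g \<subseteq> {1..n}"
  shows "rep \<one>\<^bsub>twisted_partition_monoid n\<^esub> f g = (if f = g then 1 else 0)"
  using block_constant_partition_one[OF assms] unfolding rep_def twisted_partition_monoid_def by simp

lemma monoid_twisted: "monoid (twisted_partition_monoid n)"
proof -
  let ?M = "twisted_partition_monoid n"
  have one: "snd \<one>\<^bsub>?M\<^esub> \<in> partitions n"
    using partition_one unfolding twisted_partition_monoid_def by simp
  have closed: "snd (x \<otimes>\<^bsub>?M\<^esub> y) \<in> partitions n" for x y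
    using partition_mult_closed by simp
  show ?thesis
  proof (rule monoidI; unfold twisted_carrier)
    fix x y z :: "nat \<times> vertex set set"
    assume x: "snd x \<in> partitions n"
    show "\<one>\<^bsub>?M\<^esub> \<otimes>\<^bsub>?M\<^esub> x = x"
    proof (rule rep_eqI[OF closed x])
      fix f g assume fg: "f \<subseteq> {1..n}" "g \<subseteq> {1..n}"
      have "rep (\<one>\<^bsub>?M\<^esub> \<otimes>\<^bsub>?M\<^esub> x) f g = (\<Sum>h\<in>Pow {1..n}. if f = h then rep x h g else 0)"
        unfolding rep_mult[OF one x fg] by (intro sum.cong refl) (auto simp: rep_one[OF fg(1)])
      then show "rep (\<one>\<^bsub>?M\<^esub> \<otimes>\<^bsub>?M\<^esub> x) f g = rep x f g" using fg by simp
    qed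
    show "x \<otimes>\<^bsub>?M\<^esub> \<one>\<^bsub>?M\<^esub> = x"
    proof (rule rep_eqI[OF closed x])
      fix f g assume fg: "f \<subseteq> {1..n}" "g \<subseteq> {1..n}"
      have "rep (x \<otimes>\<^bsub>?M\<^esub> \<one>\<^bsub>?M\<^esub>) f g = (\<Sum>h\<in>Pow {1..n}. if h = g then rep x f h else 0)"
        unfolding rep_mult[OF x one fg] by (intro sum.cong refl) (auto simp: rep_one[OF _ fg(2)])
      then show "rep (x \<otimes>\<^bsub>?M\<^esub> \<one>\<^bsub>?M\<^esub>) f g = rep x f g" using fg by simp
    qed
    assume y: "snd y \<in> partitions n" and z: "snd z \<in> partitions n"
    show "x \<otimes>\<^bsub>?M\<^esub> y \<otimes>\<^bsub>?M\<^esub> z = x \<otimes>\<^bsub>?M\<^esub> (y \<otimes>\<^bsub>?M\<^esub> z)"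
    proof (rule rep_eqI[OF closed closed])
      fix f g assume fg: "f \<subseteq> {1..n}" "g \<subseteq> {1..n}"
      have "rep (x \<otimes>\<^bsub>?M\<^esub> y \<otimes>\<^bsub>?M\<^esub> z) f g =
          (\<Sum>h\<in>Pow {1..n}. \<Sum>k\<in>Pow {1..n}. rep x f k * rep y k h * rep z h g)"
        unfolding rep_mult[OF closed z fg]
        by (intro sum.cong refl) (simp add: rep_mult[OF x y fg(1)] sum_distrib_right del: twisted_mult)
      also have "\<dots> = (\<Sum>k\<in>Pow {1..n}. \<Sum>h\<in>Pow {1..n}. rep x f k * (rep y k h * rep z h g))"
        by (subst sum.swap) (simp add: mult.assoc)
      also have "\<dots> = rep (x \<otimes>\<^bsub>?M\<^esub> (y \<otimes>\<^bsub>?M\<^esub> z)) f g"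
        unfolding rep_mult[OF x closed fg]
        by (intro sum.cong refl) (simp add: rep_mult[OF y z _ fg(2)] sum_distrib_left del: twisted_mult)
      finally show "rep (x \<otimes>\<^bsub>?M\<^esub> y \<otimes>\<^bsub>?M\<^esub> z) f g = rep (x \<otimes>\<^bsub>?M\<^esub> (y \<otimes>\<^bsub>?M\<^esub> z)) f g" .
    qed
  qed (use one closed in auto)
qed

section \<open>Partitions merging the points from \<open>q\<close> onwards\<close>

text \<open>With \<open>min q\<close> contracting \<open>{1..n}\<close> onto \<open>{1..q}\<close>, the block of \<open>merged n q s\<close> containing a lower
  point \<open>i\<close> contains the upper points contracted to \<open>s (min q i)\<close>; the label of \<open>Mid\<close> is irrelevant.\<close>

definition merged :: "nat \<Rightarrow> nat \<Rightarrow> (nat \<Rightarrow> nat) \<Rightarrow> vertex set set" where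
  "merged n q s = points n // {(x, y) \<in> points n \<times> points n.
     case_vertex (min q) (\<lambda>i. s (min q i)) id x = case_vertex (min q) (\<lambda>i. s (min q i)) id y}"

text \<open>For \<open>1 \<le> q \<le> n\<close> these are the sets containing all or none of the
  points \<open>q, ..., n\<close>, so there are \<open>2 ^ q\<close> of them.\<close>

definition coarse :: "nat \<Rightarrow> nat \<Rightarrow> nat set set" where
  "coarse n q = {f. f \<subseteq> {1..n} \<and> (\<forall>i\<in>{1..n}. i \<in> f \<longleftrightarrow> min q i \<in> f)}"

definition pull :: "nat \<Rightarrow> nat \<Rightarrow> (nat \<Rightarrow> nat) \<Rightarrow> nat set \<Rightarrow> nat set" where
  "pull n q s f = {i \<in> {1..n}. s (min q i) \<in> f}"

lemma merged_equiv:
  "equiv (points n) {(x, y) \<in> points n \<times> points n.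
     case_vertex (min q) (\<lambda>i. s (min q i)) id x = case_vertex (min q) (\<lambda>i. s (min q i)) id y}"
  by (rule equivI) (auto simp: refl_on_def sym_def trans_def)

lemma merged_partition: "merged n q s \<in> partitions n"
  unfolding merged_def partitions_def using partition_on_quotient[OF merged_equiv] by blast

text \<open>The label of a lower point lies in \<open>{1..q}\<close> and is also the label of an
  upper point, so \<open>f\<close> determines \<open>g\<close>. Each row of the matrix has at most
  one nonzero entry, in column \<open>pull n q s f\<close>.\<close>

lemma block_constant_merged:
  assumes q: "1 \<le> q" "q \<le> n" and s: "s \<in> {1..q} \<rightarrow> {1..q}" and fg: "f \<subseteq> {1..n}" "g \<subseteq> {1..n}"
  shows "block_constant (merged n q s) f g \<longleftrightarrow> f \<in> coarse n q \<and> g = pull n q s f" (is "?L \<longleftrightarrow> ?R")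
proof -
  let ?l = "case_vertex (min q) (\<lambda>i. s (min q i)) id"
  have L: "?L \<longleftrightarrow> (\<forall>x\<in>points n. \<forall>y\<in>points n. ?l x = ?l y \<longrightarrow> (x \<in> colour f g \<longleftrightarrow> y \<in> colour f g))"
    unfolding merged_def block_constant_quotient[OF merged_equiv] by blast
  show ?thesis
  proof
    assume ?L
    then have *: "x \<in> colour f g \<longleftrightarrow> y \<in> colour f g"
      if "x \<in> points n" "y \<in> points n" "?l x = ?l y" for x y
      using that unfolding L by blast
    have "i \<in> f \<longleftrightarrow> min q i \<in> f" if "i \<in> {1..n}" for i
      using *[of "Upper i" "Upper (min q i)"] that q by auto
    moreover have "i \<in> g \<longleftrightarrow> s (min q i) \<in> f" if "i \<in> {1..n}" for i
    proof -
      have "s (min q i) \<in> {1..q}" using s that q by (intro Pi_mem[OF s]) auto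
      then show ?thesis
        using *[of "Lower i" "Upper (s (min q i))"] that q by (auto simp: min_def)
    qed
    ultimately show ?R using fg unfolding coarse_def pull_def by blast
  next
    assume R: ?R
    have "x \<in> colour f g \<longleftrightarrow> ?l x \<in> f" if "x \<in> points n" for x
      using R that unfolding coarse_def pull_def by (cases x) auto
    then show ?L unfolding L by metis
  qed
qed

lemma pull_coarse:
  assumes "1 \<le> q" "q \<le> n" "s \<in> {1..q} \<rightarrow> {1..q}" "t \<in> {1..q} \<rightarrow> {1..q}"
  shows "pull n q s f \<in> coarse n q" "pull n q t (pull n q s f) = pull n q (s \<circ> t) f"
proof -
  show "pull n q s f \<in> coarse n q"
    using assms(1,2) unfolding pull_def coarse_def by auto
  \<comment> \<open>Values of \<open>t\<close> are at most \<open>q\<close>, so the contraction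
    between the two maps acts trivially on them.\<close>
  have "t (min q i) \<in> {1..n} \<and> min q (t (min q i)) = t (min q i)" if "i \<in> {1..n}" for i
  proof -
    have "t (min q i) \<in> {1..q}"
      using that assms(1) by (intro Pi_mem[OF assms(4)]) auto
    then show ?thesis using assms(2) by auto
  qed
  then show "pull n q t (pull n q s f) = pull n q (s \<circ> t) f"
    unfolding pull_def by (intro Collect_cong conj_cong refl) (simp del: atLeastAtMost_iff)
qed

lemma pull_id: "f \<in> coarse n q \<Longrightarrow> pull n q id f = f"
  unfolding pull_def coarse_def by auto

text \<open>Only the summand at \<open>pull n q s f\<close> can survive, so nothing is doubled, the
  twists simply add, and the maps compose.\<close>

lemma merged_mult:
  assumes q: "1 \<le> q" "q \<le> n" and s: "s \<in> {1..q} \<rightarrow> {1..q}" and t: "t \<in> {1..q} \<rightarrow> {1..q}"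
  shows "(i, merged n q s) \<otimes>\<^bsub>twisted_partition_monoid n\<^esub> (j, merged n q t) =
    (i + j, merged n q (s \<circ> t))" (is "?x \<otimes>\<^bsub>?M\<^esub> ?y = ?z")
proof (rule rep_eqI)
  show "snd (?x \<otimes>\<^bsub>?M\<^esub> ?y) \<in> partitions n" "snd ?z \<in> partitions n"
    using partition_mult_closed merged_partition by auto
  fix f g assume fg: "f \<subseteq> {1..n}" "g \<subseteq> {1..n}"
  have st: "s \<circ> t \<in> {1..q} \<rightarrow> {1..q}" using s t by auto
  have pull_sub: "pull n q s f \<in> Pow {1..n}" unfolding pull_def by blast
  have "rep (?x \<otimes>\<^bsub>?M\<^esub> ?y) f g = (\<Sum>h\<in>Pow {1..n}. rep ?x f h * rep ?y h g)"
    using merged_partition fg by (intro rep_mult) auto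
  also have "\<dots> = (\<Sum>h\<in>Pow {1..n}. if h = pull n q s f then rep ?z f g else 0)"
  proof (rule sum.cong[OF refl])
    fix h assume "h \<in> Pow {1..n}"
    then have h: "h \<subseteq> {1..n}" by blast
    show "rep ?x f h * rep ?y h g = (if h = pull n q s f then rep ?z f g else 0)"
      using pull_coarse[OF q s t, of f]
      by (auto simp: rep_def block_constant_merged[OF q s fg(1) h] block_constant_merged[OF q t h fg(2)]
          block_constant_merged[OF q st fg] power_add)
  qed
  also have "\<dots> = rep ?z f g" using pull_sub by simp
  finally show "rep (?x \<otimes>\<^bsub>?M\<^esub> ?y) f g = rep ?z f g" .
qed

text \<open>The nonzero diagonal entries of the matrix of \<open>merged n r id\<close> force an injection of
  \<open>coarse n r\<close> into \<open>coarse n q\<close>.\<close>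

lemma merged_divs:
  assumes q: "1 \<le> q" "q \<le> n" and r: "1 \<le> r" "r \<le> n"
    and u: "u \<in> partitions n" and v: "v \<in> partitions n"
    and eq: "partition_mult n (partition_mult n u (merged n q id)) v = merged n r id"
  shows "r \<le> q"
proof (rule ccontr)
  assume "\<not> r \<le> q"
  have id: "id \<in> {1..k} \<rightarrow> {1..k}" for k :: nat by simp
  have sub: "f \<subseteq> {1..n}" if "f \<in> coarse n r" for f r
    using that unfolding coarse_def by blast
  \<comment> \<open>The middle factor is diagonal with support \<open>coarse n q\<close>, so the
    matrix factors through that index set.\<close>
  have prod: "block_constant (merged n r id) f g \<longleftrightarrow> (\<exists>h\<in>coarse n q. block_constant u f h \<and> block_constant v h g)"
    if "f \<subseteq> {1..n}" "g \<subseteq> {1..n}" for f g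
  proof -
    have "block_constant (merged n r id) f g \<longleftrightarrow>
        (\<exists>h\<subseteq>{1..n}. (\<exists>k\<subseteq>{1..n}. block_constant u f k \<and> block_constant (merged n q id) k h) \<and> block_constant v h g)"
      unfolding eq[symmetric] using that u v merged_partition partition_mult_closed
      by (simp add: block_constant_partition_mult cong: conj_cong)
    also have "\<dots> \<longleftrightarrow> (\<exists>h\<in>coarse n q. block_constant u f h \<and> block_constant v h g)"
      using block_constant_merged[OF q id] pull_id sub by metis
    finally show ?thesis .
  qed
  have "\<exists>h\<in>coarse n q. block_constant u f h \<and> block_constant v h f" if "f \<in> coarse n r" for f
    using that prod[of f f] sub[OF that] block_constant_merged[OF r id, of f f] pull_id[OF that] by auto
  then obtain h where h: "\<And>f. f \<in> coarse n r \<Longrightarrow> h f \<in> coarse n q \<and> block_constant u f (h f) \<and> block_constant v (h f) f"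
    by metis
  \<comment> \<open>Two sets with the same middle colouring would give a nonzero entry at
    \<open>(f, g)\<close> of a diagonal matrix.\<close>
  have "inj_on h (coarse n r)"
  proof (rule inj_onI)
    fix f g assume fg: "f \<in> coarse n r" "g \<in> coarse n r" "h f = h g"
    then have "block_constant (merged n r id) f g"
      unfolding prod[OF sub[OF fg(1)] sub[OF fg(2)]] using h by metis
    then show "f = g"
      using block_constant_merged[OF r id sub[OF fg(1)] sub[OF fg(2)]] pull_id[OF fg(1)] by simp
  qed
  moreover have fin: "finite (coarse n k)" for k
    by (rule finite_subset[of _ "Pow {1..n}"]) (auto simp: coarse_def)
  ultimately have "card (coarse n r) \<le> card (coarse n q)"
    using h by (intro card_inj_on_le[of h]) auto
  moreover have "coarse n q \<subset> coarse n r"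
  proof
    show "coarse n q \<subseteq> coarse n r"
    proof
      fix f assume f: "f \<in> coarse n q"
      have "min q (min r i) = min q i" for i using \<open>\<not> r \<le> q\<close> by auto
      then show "f \<in> coarse n r" using f r unfolding coarse_def by (auto; metis)
    qed
    \<comment> \<open>As \<open>q < r\<close>, this set contains \<open>r\<close> but not
      \<open>q = min q r\<close>.\<close>
    have "{r..n} \<in> coarse n r" "{r..n} \<notin> coarse n q"
      using r q \<open>\<not> r \<le> q\<close> unfolding coarse_def by (auto simp: min_def)
    then show "coarse n q \<noteq> coarse n r" by blast
  qed
  ultimately show False using psubset_card_mono[OF fin] by (meson leD)
qed

section \<open>The antichain in the twisted partition monoid\<close>

lemma finite_partitions: "finite (partitions n)"
  by (rule finite_subset[of _ "Pow (Pow (points n))"])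
    (auto simp: partitions_def partition_on_def points_def)

lemma twisted_many_generators:
  assumes n: "n \<ge> 2"
  shows "\<exists>\<sigma>. monoid_congruence (twisted_partition_monoid n) \<sigma> \<and>
    (\<forall>\<Omega>. generates_congruence (twisted_partition_monoid n) \<Omega> \<sigma> \<longrightarrow> infinite \<Omega> \<or> card \<Omega> \<ge> n - 1)"
proof -
  let ?M = "twisted_partition_monoid n"
  interpret monoid ?M by (rule monoid_twisted)
  \<comment> \<open>The transposition of 1 and 2 preserves \<open>{1..q}\<close> only from
    \<open>q = 2\<close> on, which leaves \<open>n - 1\<close> values of \<open>q\<close>.\<close>
  define s :: "nat \<Rightarrow> nat" where "s i = (if i = 1 then 2 else if i = 2 then 1 else i)" for i
  define a p where "a q = (q, merged n q id)" and "p q = (0 :: nat, merged n q s)" for q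
  have s: "s \<in> {1..q} \<rightarrow> {1..q}" "id \<in> {1..q} \<rightarrow> {1..q}" if "q \<in> {2..n}" for q
    using that by (auto simp: s_def)
  have ss: "s \<circ> s = id" by (auto simp: s_def)
  have pa: "p q \<otimes>\<^bsub>?M\<^esub> a q = (q, merged n q s)" "a q \<otimes>\<^bsub>?M\<^esub> p q = (q, merged n q s)"
    "p q \<otimes>\<^bsub>?M\<^esub> (q, merged n q s) = a q" if "q \<in> {2..n}" for q
    using that merged_mult[of q n s id 0 q] merged_mult[of q n id s q 0] merged_mult[of q n s s 0 q]
      s[OF that] ss unfolding a_def p_def by (simp_all del: twisted_mult)
  have neq: "merged n q s \<noteq> merged n q id" if q: "q \<in> {2..n}" for q
  proof
    assume eq: "merged n q s = merged n q id"
    \<comment> \<open>The colouring \<open>{1}\<close> tells the two apart: the identity pulls it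
      back to itself, while \<open>s\<close> sends 1 out of it.\<close>
    have "{1} \<in> coarse n q" using q unfolding coarse_def by (auto simp: min_def)
    then have "{1} = pull n q s {1}"
      using block_constant_merged[of q n id "{1}" "{1}"] block_constant_merged[of q n s "{1}" "{1}"] eq q s[OF q] pull_id
      by auto
    moreover have "1 \<notin> pull n q s {1}"
      using q by (simp add: pull_def s_def min_def)
    ultimately show False by blast
  qed
  have fst_le: "fst z \<le> fst w" if "divs z w" for z w
    using that unfolding divs_def by auto
  have "\<exists>\<sigma>. monoid_congruence ?M \<sigma> \<and>
      (\<forall>\<Omega>. generates_congruence ?M \<Omega> \<sigma> \<longrightarrow> infinite \<Omega> \<or> card \<Omega> \<ge> card {2..n})"
  proof (rule antichain_generators[of "{2..n}" a p])
    fix q assume q: "q \<in> {2..n}"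
    show "a q \<in> carrier ?M" "p q \<in> carrier ?M"
      unfolding a_def p_def using merged_partition by auto
    show "p q \<otimes>\<^bsub>?M\<^esub> a q = a q \<otimes>\<^bsub>?M\<^esub> p q" "p q \<otimes>\<^bsub>?M\<^esub> (p q \<otimes>\<^bsub>?M\<^esub> a q) = a q"
      unfolding pa[OF q] by simp_all
    show "p q \<otimes>\<^bsub>?M\<^esub> a q \<noteq> a q"
      unfolding pa[OF q] using neq[OF q] unfolding a_def by simp
    \<comment> \<open>The monoid is infinite, but a divisor of \<open>a q\<close> has twist at most
      \<open>q\<close>.\<close>
    have "{z \<in> carrier ?M. divs z (a q)} \<subseteq> {..q} \<times> partitions n"
      using fst_le[of _ "a q"] unfolding a_def by auto
    then show "finite {z \<in> carrier ?M. divs z (a q)}"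
      using finite_partitions finite_subset by blast
    fix r assume r: "r \<in> {2..n}" and d: "divs (a q) (a r)"
    \<comment> \<open>Twist and rank compete: division cannot lower the first or raise the second,
      and both equal the index.\<close>
    have "q \<le> r" using fst_le[OF d] unfolding a_def by simp
    moreover have "r \<le> q"
      using d merged_divs[of q n r] q r unfolding divs_def a_def by auto
    ultimately show "q = r" by simp
  qed
  then show ?thesis by simp
qed

theorem mainTheorem8:
  "(\<not> (\<exists>C::nat. \<forall>n\<ge>1. \<forall>\<sigma>. monoid_congruence (twisted_partition_monoid n) \<sigma> \<longrightarrow>
            (\<exists>\<Omega> \<subseteq> carrier (twisted_partition_monoid n) \<times> carrier (twisted_partition_monoid n).
               generates_congruence (twisted_partition_monoid n) \<Omega> \<sigma> \<and> finite \<Omega> \<and> card \<Omega> \<le> C))) \<and>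
   (\<forall>n\<ge>2. \<exists>\<sigma>. monoid_congruence (twisted_partition_monoid n) \<sigma> \<and>
            (\<forall>\<Omega> \<subseteq> carrier (twisted_partition_monoid n) \<times> carrier (twisted_partition_monoid n).
               generates_congruence (twisted_partition_monoid n) \<Omega> \<sigma> \<longrightarrow>
               infinite \<Omega> \<or> card \<Omega> \<ge> n - 1))"
proof (intro conjI notI)
  assume "\<exists>C::nat. \<forall>n\<ge>1. \<forall>\<sigma>. monoid_congruence (twisted_partition_monoid n) \<sigma> \<longrightarrow>
            (\<exists>\<Omega> \<subseteq> carrier (twisted_partition_monoid n) \<times> carrier (twisted_partition_monoid n).
               generates_congruence (twisted_partition_monoid n) \<Omega> \<sigma> \<and> finite \<Omega> \<and> card \<Omega> \<le> C)"
  then obtain C where C: "\<And>n \<sigma>. n \<ge> 1 \<Longrightarrow> monoid_congruence (twisted_partition_monoid n) \<sigma> \<Longrightarrow>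
      \<exists>\<Omega>. generates_congruence (twisted_partition_monoid n) \<Omega> \<sigma> \<and> finite \<Omega> \<and> card \<Omega> \<le> C"
    by blast
  \<comment> \<open>With \<open>n = C + 2\<close> the lower bound is \<open>C + 1\<close>, just
    above the supposed uniform bound.\<close>
  obtain \<sigma> where "monoid_congruence (twisted_partition_monoid (C + 2)) \<sigma>"
    and "\<And>\<Omega>. generates_congruence (twisted_partition_monoid (C + 2)) \<Omega> \<sigma> \<Longrightarrow>
      infinite \<Omega> \<or> card \<Omega> \<ge> C + 2 - 1"
    using twisted_many_generators[of "C + 2"] by auto
  then show False using C[of "C + 2" \<sigma>] by fastforce
qed (use twisted_many_generators in blast)

end
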